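(* Let $G=(V_G,E_G)$ be a connected, infinite and locally finite graph embedded in $\mathbb{R}^d$ and equipped with a conductance $C$. For $i\in\mathbb{N}^*$ let $B_i:=[-i,i]^d$ and $Ed_G(i):=\{e=(u,v)\in E_G: u\in B_i,\ v\notin B_i\}$. Assume that the conductance $C$ is bounded from above and that there exist functions $L$ and $N$ defined on $\mathbb{N}^*$ and with values in $\mathbb{R}^*_+$ such that: (1) $\sum_{i}\frac{1}{L(i)N(i)}=+\infty$; (2) the length of any edge in $Ed_G(i)$ is less than $L(i)$; (3) the number of edges in $Ed_G(i)$ is less than $N(i)$. Then the random walk on $G$ with conductance $C$ is recurrent.
   Context: $\mathbb{N}^*$ is the set of positive integers and $\mathbb{R}^*_+$ is the set of positive real numbers. The vertices of $G$ are points of $\mathbb{R}^d$, and the length of an edge is the Euclidean distance between its endpoints. A conductance is a positive function $C$ on the set $E_G$ of unoriented edges. With $w(u):=\sum_{v\sim u}C(u,v)$ for each vertex $u$, the random walk on $G$ with conductance $C$ is the time-homogeneous Markov chain $(X_n)_n$ on $V_G$ with transition probabilities $\mathbb{P}[X_{n+1}=v\mid X_n=u]=C(u,v)/w(u)$ for $v\sim u$.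
   Formalization: L is additionally assumed bounded below by a constant c > 0 (for arbitrary positive L the claim fails, e.g. for a subdivided binary tree with very short crossing edges), and "locally finite" means finite degrees and finitely many vertices in each bounded region. *)

theory Defs
  imports "HOL-Probability.Probability"
begin

section \<open>Markov chains on the canonical path space\<close>

text \<open>
  The law on \<^typ>\<open>nat \<Rightarrow> 'v\<close> of the time-homogeneous Markov chain with transition kernel
  \<^term>\<open>K\<close> started at \<^term>\<open>u\<close>, as an Ionescu-Tulcea limit; the finite-dimensional
  distributions are given by \<open>emeasure_chain_cylinder\<close> below.
\<close>

definition chain_kernel :: "('v \<Rightarrow> 'v pmf) \<Rightarrow> 'v \<Rightarrow> nat \<Rightarrow> (nat \<Rightarrow> 'v) \<Rightarrow> 'v measure" where
  "chain_kernel K u n \<omega> = measure_pmf (if n = 0 then return_pmf u else K (\<omega> (n - 1)))"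

definition chain :: "('v \<Rightarrow> 'v pmf) \<Rightarrow> 'v \<Rightarrow> (nat \<Rightarrow> 'v) measure" where
  "chain K u =
     projective_family.lim UNIV
       (Ionescu_Tulcea.CI (chain_kernel K u) (\<lambda>_. count_space UNIV))
       (\<lambda>_. count_space UNIV)"

lemma chain_kernel_measurable:
  "chain_kernel K u n \<in> measurable (PiM {0..<n} (\<lambda>_. count_space UNIV))
     (subprob_algebra (count_space UNIV))"
proof (cases n)
  case 0
  then show ?thesis
    by (auto simp: chain_kernel_def[abs_def] space_subprob_algebra
        measure_pmf.subprob_space_axioms)
next
  case (Suc m)
  have 1: "(\<lambda>\<omega>. \<omega> m) \<in> measurable (PiM {0..<n} (\<lambda>_. count_space UNIV)) (count_space UNIV)"
    using Suc by (intro measurable_component_singleton) auto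
  have 2: "(\<lambda>x. measure_pmf (K x)) \<in> measurable (count_space UNIV) (subprob_algebra (count_space UNIV))"
    by (auto simp: space_subprob_algebra measure_pmf.subprob_space_axioms)
  show ?thesis
    using measurable_compose[OF 1 2] Suc by (simp add: chain_kernel_def[abs_def])
qed

lemma Ionescu_Tulcea_chain: "Ionescu_Tulcea (chain_kernel K u) (\<lambda>_. count_space UNIV)"
  by (rule Ionescu_Tulcea.intro, rule chain_kernel_measurable)
     (simp only: chain_kernel_def measure_pmf.prob_space_axioms)

lemma sets_chain [measurable_cong, simp]:
  "sets (chain K u) = sets (PiM UNIV (\<lambda>_. count_space UNIV))"
proof -
  interpret Ionescu_Tulcea "chain_kernel K u" "\<lambda>_. count_space UNIV"
    by (rule Ionescu_Tulcea_chain)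
  show ?thesis by (simp add: chain_def)
qed

lemma space_chain [simp]: "space (chain K u) = UNIV"
  using sets_eq_imp_space_eq[OF sets_chain, of K u] by (simp add: space_PiM)

lemma emeasure_chain_cylinder:
  "emeasure (chain K u) {\<omega>. \<forall>i\<le>n. \<omega> i = x i} =
     ennreal (indicator {u} (x 0) * (\<Prod>i<n. pmf (K (x i)) (x (Suc i))))"
proof -
  let ?M = "\<lambda>_::nat. count_space (UNIV :: 'a set)"
  interpret Ionescu_Tulcea "chain_kernel K u" ?M
    by (rule Ionescu_Tulcea_chain)
  define A where "A m = {restrict x {0..<m}}" for m
  have A_eq: "A m = PiE {0..<m} (\<lambda>i. {x i})" for m
    unfolding A_def
    by (rule trans[OF PiE_singleton[symmetric, of "restrict x {0..<m}" "{0..<m}"]])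
       (auto intro!: PiE_cong)
  have A_sets [measurable]: "A m \<in> sets (PiM {0..<m} ?M)" for m
    unfolding A_eq by (rule sets_PiM_I_finite) auto
  have upd: "fun_upd \<omega> m -` A (Suc m) = (if \<omega> \<in> A m then {x m} else {})"
    if \<omega>: "\<omega> \<in> space (PiM {0..<m} ?M)" for \<omega> m
  proof -
    have "fun_upd \<omega> m y \<in> A (Suc m) \<longleftrightarrow> \<omega> \<in> A m \<and> y = x m" for y
    proof
      assume a: "fun_upd \<omega> m y \<in> A (Suc m)"
      then have eq: "fun_upd \<omega> m y i = restrict x {0..<Suc m} i" for i
        by (simp add: A_def)
      have "\<omega> i = restrict x {0..<m} i" for i
        using eq[of i] \<omega> by (cases "i < m") (auto simp: space_PiM PiE_def extensional_def split: if_splits)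
      moreover have "y = x m" using eq[of m] by simp
      ultimately show "\<omega> \<in> A m \<and> y = x m" by (auto simp: A_def)
    next
      assume "\<omega> \<in> A m \<and> y = x m"
      then show "fun_upd \<omega> m y \<in> A (Suc m)"
        by (auto simp: A_def fun_eq_iff less_Suc_eq)
    qed
    then show ?thesis by auto
  qed
  have ker: "emeasure (chain_kernel K u m \<omega>) {x m} = emeasure (chain_kernel K u m x) {x m}"
    if "\<omega> \<in> A m" for \<omega> m
    using that by (auto simp: chain_kernel_def A_def)
  have rec: "emeasure (C 0 (Suc m) (\<lambda>_. undefined)) (A (Suc m)) =
      emeasure (chain_kernel K u m x) {x m} * emeasure (C 0 m (\<lambda>_. undefined)) (A m)" for m
  proof -
    have u: "(\<lambda>_. undefined) \<in> space (PiM {0..<0} ?M)" by (simp add: space_PiM)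
    note sC = sets_C[OF u, of m, simplified] and pC = space_C[OF u, of m, simplified]
    have "emeasure (C 0 (Suc m) (\<lambda>_. undefined)) (A (Suc m)) =
        (\<integral>\<^sup>+\<omega>. emeasure (eP m \<omega>) (A (Suc m)) \<partial>C 0 m (\<lambda>_. undefined))"
      using measurable_eP[of m] sC A_sets[of "Suc m"] pC space_PiM_not_empty
      by (simp, subst emeasure_bind[where N = "PiM {0..<Suc m} ?M"])
         (auto simp: measurable_cong_sets[OF sC] space_PiM PiE_eq_empty_iff)
    also have "\<dots> = (\<integral>\<^sup>+\<omega>. emeasure (chain_kernel K u m x) {x m} * indicator (A m) \<omega>
        \<partial>C 0 m (\<lambda>_. undefined))"
      by (intro nn_integral_cong)
         (auto simp: pC emeasure_eP upd ker split: split_indicator)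
    also have "\<dots> = emeasure (chain_kernel K u m x) {x m} * emeasure (C 0 m (\<lambda>_. undefined)) (A m)"
      by (rule nn_integral_cmult_indicator) (simp add: sC)
    finally show ?thesis .
  qed
  have C_eq: "emeasure (C 0 (Suc m) (\<lambda>_. undefined)) (A (Suc m)) =
      ennreal (indicator {u} (x 0) * (\<Prod>i<m. pmf (K (x i)) (x (Suc i))))" for m
  proof (induction m)
    case 0
    have "emeasure (C 0 0 (\<lambda>_. undefined)) (A 0) = 1"
      using A_sets[of 0] by (simp add: A_def restrict_def)
    then show ?case
      unfolding rec[of 0] by (simp add: chain_kernel_def split: split_indicator)
  next
    case (Suc m)
    show ?case
      unfolding rec[of "Suc m"] Suc
      by (simp add: chain_kernel_def emeasure_pmf_single ennreal_mult[symmetric] prod_nonneg mult_ac)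
  qed
  have "{\<omega>. \<forall>i\<le>n. \<omega> i = x i} = PF.emb UNIV {0..<Suc n} (A (Suc n))"
    by (simp add: prod_emb_def A_def space_PiM fun_eq_iff less_Suc_eq_le set_eq_iff)
  then have "emeasure (chain K u) {\<omega>. \<forall>i\<le>n. \<omega> i = x i} = emeasure (CI {0..<Suc n}) (A (Suc n))"
    unfolding chain_def using lim[of "{0..<Suc n}" "A (Suc n)"] A_sets by simp
  also have "\<dots> = emeasure (C 0 (Suc n) (\<lambda>_. undefined)) (A (Suc n))"
    using emeasure_CI[of "{0..<Suc n}" "Suc n" "A (Suc n)"] A_sets[of "Suc n"]
      prod_emb_id[of "A (Suc n)" "{0..<Suc n}" ?M] sets.sets_into_space[OF A_sets[of "Suc n"]]
    by (simp add: space_PiM del: C.simps)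
  also have "\<dots> = ennreal (indicator {u} (x 0) * (\<Prod>i<n. pmf (K (x i)) (x (Suc i))))"
    by (rule C_eq)
  finally show ?thesis .
qed

lemma prob_space_chain: "prob_space (chain K u)"
proof -
  interpret Ionescu_Tulcea "chain_kernel K u" "\<lambda>_. count_space UNIV"
    by (rule Ionescu_Tulcea_chain)
  have m: "(\<lambda>\<omega>. restrict \<omega> {}) \<in> measurable (chain K u) (PiM {} (\<lambda>_. count_space UNIV))"
    by (subst measurable_cong_sets[OF sets_chain refl])
       (rule measurable_restrict_subset, simp)
  have "distr (chain K u) (PiM {} (\<lambda>_. count_space UNIV)) (\<lambda>\<omega>. restrict \<omega> {}) = CI {}"
    unfolding chain_def by (rule distr_lim) simp
  moreover have "prob_space (CI {})" by (rule PF.prob_space_P) auto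
  ultimately show ?thesis using prob_space_distrD[OF m] by metis
qed


section \<open>Graphs with conductances and their random walks\<close>

text \<open>
  A graph is a set \<open>V\<close> of vertices with a set \<open>E\<close> of two-element subsets of \<open>V\<close>;
  a conductance is a function on unoriented edges.
\<close>

definition graph :: "'v set \<Rightarrow> 'v set set \<Rightarrow> bool" where
  "graph V E \<longleftrightarrow> (\<forall>e\<in>E. \<exists>u\<in>V. \<exists>v\<in>V. u \<noteq> v \<and> e = {u, v})"

definition neighbors :: "'v set set \<Rightarrow> 'v \<Rightarrow> 'v set" where
  "neighbors E u = {v. {u, v} \<in> E}"

definition connected_graph :: "'v set \<Rightarrow> 'v set set \<Rightarrow> bool" where
  "connected_graph V E \<longleftrightarrow> (\<forall>u\<in>V. \<forall>v\<in>V. (\<lambda>x y. {x, y} \<in> E)\<^sup>*\<^sup>* u v)"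

definition conductance :: "'v set set \<Rightarrow> ('v set \<Rightarrow> real) \<Rightarrow> bool" where
  "conductance E C \<longleftrightarrow> (\<forall>e\<in>E. C e > 0)"

definition weight :: "'v set set \<Rightarrow> ('v set \<Rightarrow> real) \<Rightarrow> 'v \<Rightarrow> real" where
  "weight E C u = (\<Sum>v\<in>neighbors E u. C {u, v})"

definition walk_step :: "'v set set \<Rightarrow> ('v set \<Rightarrow> real) \<Rightarrow> 'v \<Rightarrow> 'v pmf" where
  "walk_step E C u =
     embed_pmf (\<lambda>v. if v \<in> neighbors E u then C {u, v} / weight E C u else 0)"

lemma pmf_walk_step:
  assumes "conductance E C" "finite (neighbors E u)" "neighbors E u \<noteq> {}"
  shows "pmf (walk_step E C u) v =
    (if v \<in> neighbors E u then C {u, v} / weight E C u else 0)"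
proof -
  have pos: "C {u, v} > 0" if "v \<in> neighbors E u" for v
    using assms(1) that by (auto simp: conductance_def neighbors_def)
  have w: "weight E C u > 0"
    unfolding weight_def using assms pos by (intro sum_pos) auto
  have "(\<integral>\<^sup>+v. ennreal (if v \<in> neighbors E u then C {u, v} / weight E C u else 0)
      \<partial>count_space UNIV) = (\<Sum>v\<in>neighbors E u. ennreal (C {u, v} / weight E C u))"
    by (subst nn_integral_count_space'[OF assms(2)]) (simp_all cong: sum.cong)
  also have "\<dots> = ennreal (\<Sum>v\<in>neighbors E u. C {u, v} / weight E C u)"
    using pos w by (intro sum_ennreal) (auto intro: less_imp_le)
  also have "(\<Sum>v\<in>neighbors E u. C {u, v} / weight E C u) = 1"
    using w by (simp add: sum_divide_distrib[symmetric] weight_def)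
  finally show ?thesis
    unfolding walk_step_def using pos w
    by (subst pmf_embed_pmf) (auto intro: less_imp_le)
qed

definition random_walk :: "'v set set \<Rightarrow> ('v set \<Rightarrow> real) \<Rightarrow> 'v \<Rightarrow> (nat \<Rightarrow> 'v) measure" where
  "random_walk E C u = chain (walk_step E C) u"

definition recurrent_walk :: "'v set \<Rightarrow> 'v set set \<Rightarrow> ('v set \<Rightarrow> real) \<Rightarrow> bool" where
  "recurrent_walk V E C \<longleftrightarrow>
     (\<forall>u\<in>V. AE X in random_walk E C u. \<exists>n\<ge>1. X n = u)"


section \<open>Graphs embedded in Euclidean space\<close>

text \<open>
  Local finiteness of an embedded graph: finite degrees, and only finitely many vertices in
  every bounded region.  The second part is needed: an infinite graph all of whose vertices
  lie in one box (say a copy of the lattice \<open>\<int>\<^sup>3\<close> in the unit ball) has no edge leaving a box.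
\<close>

definition locally_finite_graph ::
    "('a :: metric_space) set \<Rightarrow> 'a set set \<Rightarrow> bool" where
  "locally_finite_graph V E \<longleftrightarrow>
     (\<forall>u\<in>V. finite (neighbors E u)) \<and> (\<forall>S. bounded S \<longrightarrow> finite (V \<inter> S))"

definition box_B :: "nat \<Rightarrow> (real ^ 'd) set" where
  "box_B i = {x. \<forall>k. - real i \<le> x $ k \<and> x $ k \<le> real i}"

definition Ed :: "(real ^ 'd) set set \<Rightarrow> nat \<Rightarrow> (real ^ 'd) set set" where
  "Ed E i = {e \<in> E. \<exists>u v. e = {u, v} \<and> u \<in> box_B i \<and> v \<notin> box_B i}"

text \<open>
  The theorem assumes a bound \<open>c > 0\<close> below \<open>L\<close>.  Without it the conclusion fails: give the binary
  tree \<open>2\<^sup>k\<close> very short edges across the boundary of \<open>B\<^sub>k\<close>, subdivided so that the long edges stay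
  between two consecutive boundaries.  Then \<open>L k = 2 powr (-k)\<close> and \<open>N k = 2 ^ k + 1\<close> satisfy all other
  hypotheses with unit conductances, and the walk is transient.
\<close>

end

theory Submission
  imports Defs
begin

text \<open>
  The proof follows the classical principle that a network is recurrent once it carries finitely
  supported functions, equal to \<open>1\<close> at a given vertex, of arbitrarily small Dirichlet energy.

  Let \<open>h v\<close> be the probability that the walk from \<open>v \<noteq> u\<close> never visits \<open>u\<close>, and \<open>h u = 0\<close>.  It takes
  values in \<open>[0, 1]\<close> and is harmonic off \<open>u\<close>, so \<open>h v * (\<Delta>h) v = 0\<close> at every vertex, also at \<open>u\<close>.
  Pairing \<open>\<Delta>h\<close> with \<open>f\<^sup>2 h\<close> for a finitely supported \<open>f\<close> gives a Caccioppoli inequality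
  (\<open>caccioppoli\<close>): up to a constant, the energy of \<open>f\<close> bounds the energy of \<open>h\<close> weighted by \<open>f\<^sup>2\<close>.
  If \<open>f u = 1\<close>, the latter is at least the sum of \<open>C(u, w) (h w)\<^sup>2\<close> over the neighbours \<open>w\<close> of \<open>u\<close>.
  Letting the energy of \<open>f\<close> tend to \<open>0\<close>, \<open>h\<close> vanishes at the neighbours of \<open>u\<close>, that is, the walk
  from \<open>u\<close> returns almost surely (\<open>recurrent_walk_if_small_energy\<close>).  The factor \<open>f\<^sup>2\<close>
  makes the pairing a finite sum, while \<open>h\<close> itself is only known to be bounded.

  The cut-offs come from the boxes: leaving the box \<open>B\<^sub>i\<close> costs \<open>a i = 1 / (L i * N i)\<close>, and \<open>f\<close>
  decreases from \<open>1\<close> to \<open>0\<close> in proportion to the cost paid for \<open>j < i \<le> n\<close>.  An edge leaving several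
  boxes is shorter than each of the corresponding \<open>L i\<close>, so by Cauchy-Schwarz the square of its
  increment is at most \<open>(1 + 1/c) L i (a i)\<^sup>2\<close> summed over these boxes.  Fewer than \<open>N i\<close> edges leave
  \<open>B\<^sub>i\<close>, so this box contributes at most a multiple of \<open>L i * N i * (a i)\<^sup>2 = a i\<close> (\<open>depth_energy\<close>).  With \<open>S\<close> the
  total cost, normalising by \<open>S\<close> leaves an energy of order \<open>S / S\<^sup>2 = 1 / S\<close>, which tends to \<open>0\<close>
  because the series of the \<open>a i\<close> diverges.
\<close>

section \<open>Avoiding a state\<close>

text \<open>
  For a chain with finitely supported steps, the probability of not being in \<open>z\<close> at the times
  \<open>1, \<dots>, k\<close> when started at \<open>v\<close>.  Time \<open>0\<close> is left out, so that \<open>avoid K u k u\<close> concerns returns to \<open>u\<close>.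
\<close>

primrec avoid :: "('v \<Rightarrow> 'v pmf) \<Rightarrow> 'v \<Rightarrow> nat \<Rightarrow> 'v \<Rightarrow> real" where
  "avoid K z 0 v = 1"
| "avoid K z (Suc k) v = (\<Sum>w\<in>set_pmf (K v) - {z}. pmf (K v) w * avoid K z k w)"

lemma avoid_nonneg: "0 \<le> avoid K z k v"
  by (induction k arbitrary: v) (auto intro!: sum_nonneg)

lemma avoid_Suc_le:
  assumes "\<And>v. v \<in> V \<Longrightarrow> finite (set_pmf (K v)) \<and> set_pmf (K v) \<subseteq> V" and "v \<in> V"
  shows "avoid K z (Suc k) v \<le> avoid K z k v"
  using assms(2)
proof (induction k arbitrary: v)
  case 0
  have "(\<Sum>w\<in>set_pmf (K v) - {z}. pmf (K v) w) \<le> (\<Sum>w\<in>set_pmf (K v). pmf (K v) w)"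
    using assms(1)[OF 0] by (intro sum_mono2) auto
  also have "\<dots> = 1" using assms(1)[OF 0] by (intro sum_pmf_eq_1) auto
  finally show ?case by simp
next
  case (Suc k)
  have "avoid K z (Suc (Suc k)) v = (\<Sum>w\<in>set_pmf (K v) - {z}. pmf (K v) w * avoid K z (Suc k) w)"
    by (rule avoid.simps)
  also have "\<dots> \<le> (\<Sum>w\<in>set_pmf (K v) - {z}. pmf (K v) w * avoid K z k w)"
    using assms(1)[OF Suc.prems] by (intro sum_mono mult_left_mono Suc.IH) auto
  finally show ?case by simp
qed

lemma sets_chain_all_nat [measurable]:
  "{\<omega>. \<forall>i. Q i \<longrightarrow> \<omega> i \<in> A i} \<in> sets (chain K u)"
proof -
  let ?P = "PiM UNIV (\<lambda>_::nat. count_space (UNIV :: 'a set))"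
  have [measurable]: "Measurable.pred ?P (\<lambda>\<omega>. \<omega> i \<in> A i)" for i
    using measurable_compose[OF measurable_component_singleton[of i UNIV "\<lambda>_. count_space UNIV"],
        of "\<lambda>x. x \<in> A i" "count_space UNIV"] by simp
  have "{\<omega> \<in> space ?P. \<forall>i. Q i \<longrightarrow> \<omega> i \<in> A i} \<in> sets ?P"
    by measurable
  then show ?thesis by (simp add: space_PiM)
qed

text \<open>
  The Markov property, in the only form required, derived from the cylinder formula alone: the
  continuations of a cylinder by the states in the support of the next step exhaust its mass,
  so the other continuations, of which there may be uncountably many, together form a null set.
\<close>

lemma emeasure_chain_avoid_le:
  assumes V: "\<And>v. v \<in> V \<Longrightarrow> finite (set_pmf (K v)) \<and> set_pmf (K v) \<subseteq> V" and "x m \<in> V"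
  shows "emeasure (chain K u) {\<omega>. (\<forall>i\<le>m. \<omega> i = x i) \<and> (\<forall>i. m < i \<and> i \<le> m + k \<longrightarrow> \<omega> i \<noteq> z)}
    \<le> emeasure (chain K u) {\<omega>. \<forall>i\<le>m. \<omega> i = x i} * ennreal (avoid K z k (x m))"
  using assms(2)
proof (induction k arbitrary: m x)
  case 0
  have "{\<omega>. (\<forall>i\<le>m. \<omega> i = x i) \<and> (\<forall>i. m < i \<and> i \<le> m + 0 \<longrightarrow> \<omega> i \<noteq> z)} = {\<omega>. \<forall>i\<le>m. \<omega> i = x i}"
    by auto
  then show ?case by (simp only: avoid.simps ennreal_1 mult_1_right order_refl)
next
  case (Suc k)
  interpret prob_space "chain K u" by (rule prob_space_chain)
  let ?S = "set_pmf (K (x m))"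
  have S: "finite ?S" "?S \<subseteq> V" using V[OF Suc.prems] by auto
  define cyl where "cyl m x = {\<omega> :: nat \<Rightarrow> 'a. \<forall>i\<le>m. \<omega> i = x i}" for m and x :: "nat \<Rightarrow> 'a"
  have cyl_sets: "cyl m x \<in> sets (chain K u)" for m x
    using sets_chain_all_nat[of "\<lambda>i. i \<le> m" "\<lambda>i. {x i}"] by (simp add: cyl_def)
  define ev where "ev m x k = {\<omega>. (\<forall>i\<le>m. \<omega> i = x i) \<and> (\<forall>i. m < i \<and> i \<le> m + k \<longrightarrow> \<omega> i \<noteq> z)}"
    for m k and x :: "nat \<Rightarrow> 'a"
  have ev_sets: "ev m x k \<in> sets (chain K u)" for m x k
  proof -
    have "ev m x k = cyl m x \<inter> {\<omega>. \<forall>i. m < i \<and> i \<le> m + k \<longrightarrow> \<omega> i \<in> - {z}}"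
      by (auto simp: ev_def cyl_def)
    then show ?thesis by (simp only:) (rule sets.Int[OF cyl_sets sets_chain_all_nat])
  qed
  define y where "y w = x(Suc m := w)" for w
  have cyl_y: "emeasure (chain K u) (cyl (Suc m) (y w)) =
      emeasure (chain K u) (cyl m x) * ennreal (pmf (K (x m)) w)" for w
    unfolding cyl_def emeasure_chain_cylinder
    by (simp add: y_def ennreal_mult[symmetric] prod_nonneg mult.assoc)
  have union: "emeasure (chain K u) (\<Union>w\<in>?S. cyl (Suc m) (y w)) = emeasure (chain K u) (cyl m x)"
  proof -
    have "disjoint_family_on (\<lambda>w. cyl (Suc m) (y w)) ?S"
      by (auto simp: disjoint_family_on_def cyl_def y_def)
    then have "(\<Sum>w\<in>?S. emeasure (chain K u) (cyl (Suc m) (y w))) =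
        emeasure (chain K u) (\<Union>w\<in>?S. cyl (Suc m) (y w))"
      using S(1) cyl_sets by (intro sum_emeasure) blast+
    moreover have "(\<Sum>w\<in>?S. emeasure (chain K u) (cyl (Suc m) (y w))) =
        emeasure (chain K u) (cyl m x) * ennreal (\<Sum>w\<in>?S. pmf (K (x m)) w)"
      by (simp add: cyl_y sum_distrib_left[symmetric])
    moreover have "(\<Sum>w\<in>?S. pmf (K (x m)) w) = 1"
      using S(1) by (intro sum_pmf_eq_1) auto
    ultimately show ?thesis by simp
  qed
  define R where "R = cyl m x - (\<Union>w\<in>?S. cyl (Suc m) (y w))"
  have sub: "(\<Union>w\<in>?S. cyl (Suc m) (y w)) \<subseteq> cyl m x"
    by (force simp: cyl_def y_def)
  have US: "(\<Union>w\<in>?S. cyl (Suc m) (y w)) \<in> sets (chain K u)"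
    using S(1) cyl_sets by (intro sets.finite_UN) auto
  have R: "R \<in> sets (chain K u)" "emeasure (chain K u) R = 0"
    using cyl_sets US emeasure_Diff[OF _ cyl_sets US sub] by (auto simp: R_def union)
  have cover: "ev m x (Suc k) \<subseteq> R \<union> (\<Union>w\<in>?S - {z}. ev (Suc m) (y w) k)"
  proof
    fix \<omega> assume w: "\<omega> \<in> ev m x (Suc k)"
    show "\<omega> \<in> R \<union> (\<Union>w\<in>?S - {z}. ev (Suc m) (y w) k)"
    proof (cases "\<omega> (Suc m) \<in> ?S")
      case True
      have "\<omega> (Suc m) \<noteq> z" using w by (auto simp: ev_def)
      moreover have "\<omega> \<in> ev (Suc m) (y (\<omega> (Suc m))) k"
        using w by (auto simp: ev_def y_def)
      ultimately show ?thesis using True by blast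
    next
      case False
      then show ?thesis using w by (auto simp: ev_def R_def cyl_def y_def)
    qed
  qed
  have "emeasure (chain K u) (ev m x (Suc k))
      \<le> emeasure (chain K u) (R \<union> (\<Union>w\<in>?S - {z}. ev (Suc m) (y w) k))"
    using S(1) R(1) ev_sets by (intro emeasure_mono[OF cover]) (auto intro!: sets.finite_UN)
  also have "\<dots> \<le> emeasure (chain K u) R + emeasure (chain K u) (\<Union>w\<in>?S - {z}. ev (Suc m) (y w) k)"
    using S(1) R(1) ev_sets by (intro emeasure_subadditive) (auto intro!: sets.finite_UN)
  also have "\<dots> = emeasure (chain K u) (\<Union>w\<in>?S - {z}. ev (Suc m) (y w) k)"
    using R(2) by simp
  also have "\<dots> \<le> (\<Sum>w\<in>?S - {z}. emeasure (chain K u) (ev (Suc m) (y w) k))"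
    using S(1) ev_sets by (intro emeasure_subadditive_finite) auto
  also have "\<dots> \<le> (\<Sum>w\<in>?S - {z}. emeasure (chain K u) (cyl (Suc m) (y w)) * ennreal (avoid K z k w))"
  proof (rule sum_mono)
    fix w assume "w \<in> ?S - {z}"
    then have "y w (Suc m) \<in> V" using S(2) by (auto simp: y_def)
    from Suc.IH[of "y w" "Suc m", OF this]
    show "emeasure (chain K u) (ev (Suc m) (y w) k) \<le>
        emeasure (chain K u) (cyl (Suc m) (y w)) * ennreal (avoid K z k w)"
      by (simp add: ev_def cyl_def y_def)
  qed
  also have "\<dots> = emeasure (chain K u) (cyl m x) *
      (\<Sum>w\<in>?S - {z}. ennreal (pmf (K (x m)) w * avoid K z k w))"
    by (simp add: cyl_y sum_distrib_left ennreal_mult avoid_nonneg mult.assoc)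
  also have "\<dots> = emeasure (chain K u) (cyl m x) * ennreal (avoid K z (Suc k) (x m))"
    by (simp add: avoid_nonneg)
  finally show ?case by (simp add: ev_def cyl_def)
qed

lemma AE_chain_return:
  assumes V: "\<And>v. v \<in> V \<Longrightarrow> finite (set_pmf (K v)) \<and> set_pmf (K v) \<subseteq> V" and "u \<in> V"
    and lim: "(\<lambda>k. avoid K u k u) \<longlonglongrightarrow> 0"
  shows "AE X in chain K u. \<exists>n\<ge>1. X n = u"
proof -
  interpret prob_space "chain K u" by (rule prob_space_chain)
  let ?start = "{\<omega>. \<forall>i\<le>0. \<omega> i = u}"
  let ?bad = "{\<omega>. \<forall>i. 1 \<le> i \<longrightarrow> \<omega> i \<in> - {u}}"
  have start: "emeasure (chain K u) ?start = 1"
    using emeasure_chain_cylinder[of K u 0 "\<lambda>_. u"] by simp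
  have ms: "?start \<in> sets (chain K u)"
    using sets_chain_all_nat[of "\<lambda>i. i \<le> 0" "\<lambda>_. {u}" K u] by simp
  have AE_start: "AE X in chain K u. X \<in> ?start"
    using start ms by (subst AE_in_set_eq_1) (auto simp: emeasure_eq_measure)
  have le: "emeasure (chain K u) (?start \<inter> ?bad) \<le> ennreal (avoid K u k u)" for k
  proof -
    have eq: "{\<omega>. (\<forall>i\<le>0. \<omega> i = u) \<and> (\<forall>i. 0 < i \<and> i \<le> 0 + k \<longrightarrow> \<omega> i \<noteq> u)} =
        ?start \<inter> {\<omega>. \<forall>i. 0 < i \<and> i \<le> 0 + k \<longrightarrow> \<omega> i \<in> - {u}}" by auto
    have "emeasure (chain K u) (?start \<inter> ?bad) \<le> emeasure (chain K u)
        {\<omega>. (\<forall>i\<le>0. \<omega> i = u) \<and> (\<forall>i. 0 < i \<and> i \<le> 0 + k \<longrightarrow> \<omega> i \<noteq> u)}"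
      unfolding eq by (rule emeasure_mono, force) (intro sets.Int ms sets_chain_all_nat)
    also have "\<dots> \<le> ennreal (avoid K u k u)"
      using emeasure_chain_avoid_le[of V K "\<lambda>_. u" 0 u k u, OF V \<open>u \<in> V\<close>]
      by (simp only: start mult_1)
    finally show ?thesis .
  qed
  have "emeasure (chain K u) (?start \<inter> ?bad) \<le> ennreal 0"
    by (rule LIMSEQ_le_const[OF tendsto_ennrealI[OF lim]]) (use le in blast)
  then have "?start \<inter> ?bad \<in> null_sets (chain K u)"
    using ms sets_chain_all_nat[of "\<lambda>i. 1 \<le> i" "\<lambda>_. - {u}" K u] by (auto simp: null_sets_def)
  from AE_not_in[OF this] AE_start show ?thesis
  proof eventually_elim
    case (elim X)
    then have "X \<notin> ?bad" by blast
    then obtain n where "1 \<le> n" "X n = u" by blast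
    then show ?case by blast
  qed
qed

section \<open>A Caccioppoli inequality\<close>

text \<open>
  Every edge touching \<open>A\<close> occurs in both orientations, so that sums over this set may be
  antisymmetrised.
\<close>

definition edge_pairs :: "'v set set \<Rightarrow> 'v set \<Rightarrow> ('v \<times> 'v) set" where
  "edge_pairs E A = {(v, w). {v, w} \<in> E \<and> (v \<in> A \<or> w \<in> A)}"

lemma finite_edge_pairs:
  assumes "finite A" "\<And>v. v \<in> A \<Longrightarrow> finite (neighbors E v)"
  shows "finite (edge_pairs E A)"
proof -
  have "edge_pairs E A \<subseteq> (SIGMA v:A. neighbors E v) \<union> (SIGMA v:A. neighbors E v)\<inverse>"
    by (auto simp: edge_pairs_def neighbors_def insert_commute)
  moreover have "finite \<dots>" using assms by (auto intro!: finite_SigmaI)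
  ultimately show ?thesis by (rule finite_subset)
qed

text \<open>
  Here \<open>a, b\<close> are the values of \<open>h\<close> and \<open>s, t\<close> those of \<open>f\<close> at the ends of an edge.  The
  expression \<open>(a - b) (s\<^sup>2 a - t\<^sup>2 b)\<close> is \<open>(s\<^sup>2 + t\<^sup>2)/2 (a - b)\<^sup>2\<close> plus a cross term with factor
  \<open>s - t\<close>; completing the square absorbs half of the first summand into the cross term.
\<close>

lemma caccioppoli_pointwise:
  fixes a b s t :: real
  assumes "0 \<le> a" "a \<le> 1" "0 \<le> b" "b \<le> 1"
  shows "(s\<^sup>2 + t\<^sup>2) * (a - b)\<^sup>2 \<le> 8 * (s - t)\<^sup>2 + 4 * ((a - b) * (s\<^sup>2 * a - t\<^sup>2 * b))"
proof -
  define m where "m = (a + b) / 2"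
  have m: "m\<^sup>2 \<le> 1" using assms by (auto simp: m_def abs_square_le_1)
  have "0 \<le> (4 * m * (s - t) + (s + t) * (a - b))\<^sup>2 / 2 + (s - t)\<^sup>2 * (a - b)\<^sup>2 / 2
      + 8 * (1 - m\<^sup>2) * (s - t)\<^sup>2"
    using m by simp
  also have "\<dots> = 8 * (s - t)\<^sup>2 + 4 * ((a - b) * (s\<^sup>2 * a - t\<^sup>2 * b)) - (s\<^sup>2 + t\<^sup>2) * (a - b)\<^sup>2"
    unfolding m_def by (simp add: field_simps power2_eq_square)
  finally show ?thesis by simp
qed

text \<open>
  Summation by parts: the sum of \<open>f\<^sup>2 h \<Delta>h\<close> is nonnegative, and its antisymmetrised form is minus
  half the sum of the products estimated in \<open>caccioppoli_pointwise\<close>.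
\<close>

lemma caccioppoli:
  fixes h f :: "'v \<Rightarrow> real"
  assumes A: "finite A" "\<And>v. v \<in> A \<Longrightarrow> finite (neighbors E v)"
    and C: "conductance E C"
    and f: "\<And>v w. {v, w} \<in> E \<Longrightarrow> v \<notin> A \<Longrightarrow> f v = 0"
    and h: "\<And>v. 0 \<le> h v" "\<And>v. h v \<le> 1"
    and sub: "\<And>v. v \<in> A \<Longrightarrow> 0 \<le> h v * (\<Sum>w\<in>neighbors E v. C {v, w} * (h w - h v))"
  shows "(\<Sum>(v, w)\<in>edge_pairs E A. C {v, w} * ((f v)\<^sup>2 + (f w)\<^sup>2) * (h v - h w)\<^sup>2)
    \<le> 8 * (\<Sum>(v, w)\<in>edge_pairs E A. C {v, w} * (f v - f w)\<^sup>2)"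
proof -
  let ?P = "edge_pairs E A"
  note fin = finite_edge_pairs[OF A]
  define T where "T = (\<Sum>(v, w)\<in>?P. C {v, w} * (h w - h v) * ((f v)\<^sup>2 * h v))"
  have swap: "T = (\<Sum>(v, w)\<in>?P. C {v, w} * (h v - h w) * ((f w)\<^sup>2 * h w))"
    unfolding T_def
    by (rule sum.reindex_bij_witness[of _ prod.swap prod.swap])
       (auto simp: edge_pairs_def insert_commute)
  have "T = (\<Sum>(v, w)\<in>(SIGMA v:A. neighbors E v). C {v, w} * (h w - h v) * ((f v)\<^sup>2 * h v))"
    unfolding T_def
  proof (rule sum.mono_neutral_right[OF fin])
    show "\<forall>p\<in>?P - (SIGMA v:A. neighbors E v). (case p of (v, w) \<Rightarrow> C {v, w} * (h w - h v) * ((f v)\<^sup>2 * h v)) = 0"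
    proof
      fix p assume "p \<in> ?P - (SIGMA v:A. neighbors E v)"
      then obtain v w where p: "p = (v, w)" "{v, w} \<in> E" "v \<notin> A"
        by (cases p) (auto simp: edge_pairs_def neighbors_def)
      then show "(case p of (v, w) \<Rightarrow> C {v, w} * (h w - h v) * ((f v)\<^sup>2 * h v)) = 0"
        using f[of v w] by simp
    qed
  qed (auto simp: edge_pairs_def neighbors_def)
  also have "\<dots> = (\<Sum>v\<in>A. \<Sum>w\<in>neighbors E v. C {v, w} * (h w - h v) * ((f v)\<^sup>2 * h v))"
    using A by (subst sum.Sigma) auto
  also have "\<dots> = (\<Sum>v\<in>A. (f v)\<^sup>2 * (h v * (\<Sum>w\<in>neighbors E v. C {v, w} * (h w - h v))))"
    by (simp add: sum_distrib_left mult_ac)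
  also have "\<dots> \<ge> 0" by (intro sum_nonneg mult_nonneg_nonneg[OF zero_le_power2 sub])
  finally have T: "0 \<le> T" .
  have "(\<Sum>(v, w)\<in>?P. C {v, w} * ((f v)\<^sup>2 + (f w)\<^sup>2) * (h v - h w)\<^sup>2)
    \<le> (\<Sum>(v, w)\<in>?P. 8 * (C {v, w} * (f v - f w)\<^sup>2) +
        4 * (- (C {v, w} * (h w - h v) * ((f v)\<^sup>2 * h v)) - C {v, w} * (h v - h w) * ((f w)\<^sup>2 * h w)))"
  proof (intro sum_mono, clarify)
    fix v w assume "(v, w) \<in> ?P"
    then have "0 \<le> C {v, w}"
      using C by (auto simp: edge_pairs_def conductance_def intro: less_imp_le)
    from mult_left_mono[OF caccioppoli_pointwise[OF h(1)[of v] h(2)[of v] h(1)[of w] h(2)[of w],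
          of "f v" "f w"] this]
    show "C {v, w} * ((f v)\<^sup>2 + (f w)\<^sup>2) * (h v - h w)\<^sup>2 \<le> 8 * (C {v, w} * (f v - f w)\<^sup>2) +
        4 * (- (C {v, w} * (h w - h v) * ((f v)\<^sup>2 * h v)) - C {v, w} * (h v - h w) * ((f w)\<^sup>2 * h w))"
      by (simp add: algebra_simps)
  qed
  also have "\<dots> = 8 * (\<Sum>(v, w)\<in>?P. C {v, w} * (f v - f w)\<^sup>2) + 4 * (- T - T)"
    by (subst (2) swap, unfold T_def)
       (simp add: case_prod_unfold sum.distrib sum_subtractf sum_negf sum_distrib_left)
  finally show ?thesis using T by simp
qed

section \<open>Cut-offs by boxes\<close>

lemma box_B_mono: "i \<le> j \<Longrightarrow> box_B i \<subseteq> box_B j"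
  unfolding box_B_def by (auto intro: order_trans[of _ "real i"] order_trans[of _ "- real i"])

text \<open>
  In the supremum norm, the end in the smaller box has norm at most \<open>i\<close> and the other one, outside
  the larger box, norm more than \<open>j\<close>.
\<close>

lemma crossing_index_gap:
  fixes v w :: "real ^ 'd"
  assumes "i \<le> j" "(v \<in> box_B i) \<noteq> (w \<in> box_B i)" "(v \<in> box_B j) \<noteq> (w \<in> box_B j)"
  shows "real j - real i \<le> dist v w"
proof -
  have *: "real j - real i \<le> dist x y" if "x \<in> box_B i" "y \<notin> box_B j" for x y :: "real ^ 'd"
  proof -
    obtain k where "\<not> (- real j \<le> y $ k \<and> y $ k \<le> real j)"
      using \<open>y \<notin> box_B j\<close> by (auto simp: box_B_def)
    then have k: "\<bar>y $ k\<bar> > real j" by linarith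
    have "\<bar>x $ k\<bar> \<le> real i"
      using \<open>x \<in> box_B i\<close> unfolding box_B_def by (metis (mono_tags, lifting) abs_le_iff mem_Collect_eq minus_le_iff)
    with k have "real j - real i \<le> \<bar>(x - y) $ k\<bar>" by simp
    also have "\<dots> \<le> dist x y" unfolding dist_norm by (rule component_le_norm_cart)
    finally show ?thesis .
  qed
  show ?thesis
    using assms *[of v w] *[of w v] box_B_mono[OF \<open>i \<le> j\<close>, where 'a = 'd]
    by (auto simp: dist_commute)
qed

lemma card_crossed_boxes:
  fixes v w :: "real ^ 'd"
  assumes "finite I" "\<And>i. i \<in> I \<Longrightarrow> (v \<in> box_B i) \<noteq> (w \<in> box_B i)"
  shows "real (card I) \<le> dist v w + 1"
proof (cases "I = {}")
  case False
  have "card I \<le> card {Min I..Max I}" using assms(1) False by (intro card_mono) auto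
  moreover have "Min I \<le> Max I" using assms(1) False by simp
  moreover from this have "real (Max I) - real (Min I) \<le> dist v w"
    using assms False by (intro crossing_index_gap) auto
  ultimately show ?thesis by simp
qed simp

lemma card_ordered_Ed:
  assumes "finite (Ed E i)"
  shows "finite {(v, w). {v, w} \<in> Ed E i}" "card {(v, w). {v, w} \<in> Ed E i} \<le> 2 * card (Ed E i)"
proof -
  \<comment> \<open>The orientation of an edge leaving the box is determined by whether its first end is inside.\<close>
  let ?g = "\<lambda>(v, w). ({v, w}, v \<in> box_B i)"
  have inj: "inj_on ?g {(v, w). {v, w} \<in> Ed E i}"
    by (auto simp: inj_on_def Ed_def doubleton_eq_iff)
  have img: "?g ` {(v, w). {v, w} \<in> Ed E i} \<subseteq> Ed E i \<times> UNIV" by auto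
  have fin: "finite (Ed E i \<times> (UNIV :: bool set))" using assms by simp
  show "finite {(v, w). {v, w} \<in> Ed E i}"
    using inj_on_finite[OF inj img fin] .
  show "card {(v, w). {v, w} \<in> Ed E i} \<le> 2 * card (Ed E i)"
    using card_inj_on_le[OF inj img fin] by (simp add: card_cartesian_product)
qed

definition depth :: "(nat \<Rightarrow> real) \<Rightarrow> nat set \<Rightarrow> real ^ 'd \<Rightarrow> real" where
  "depth a J v = (\<Sum>i\<in>{i\<in>J. v \<notin> box_B i}. a i)"

text \<open>
  The increment of the depth along an edge is at most the sum of \<open>a i\<close> over the boxes that it leaves
  or enters.  There are at most \<open>dist v w + 1\<close> of these, which is at most \<open>(1 + 1/c) L i\<close> for each of
  them: the bound \<open>c\<close> below \<open>L\<close> is what absorbs the \<open>1\<close>.  Then the sums over edges and boxes are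
  exchanged, and the number of edges crossing a box is bounded.
\<close>

lemma depth_energy:
  fixes E :: "(real ^ 'd) set set" and L N :: "nat \<Rightarrow> real"
  assumes J: "finite J" "\<And>i. i \<in> J \<Longrightarrow> 1 \<le> i"
    and P: "finite P" "\<And>v w. (v, w) \<in> P \<Longrightarrow> {v, w} \<in> E"
    and LN: "c > 0" "\<And>i. i \<ge> 1 \<Longrightarrow> L i \<ge> c" "\<And>i. i \<ge> 1 \<Longrightarrow> N i > 0"
    and len: "\<And>i u v. i \<ge> 1 \<Longrightarrow> {u, v} \<in> Ed E i \<Longrightarrow> dist u v < L i"
    and num: "\<And>i. i \<ge> 1 \<Longrightarrow> finite (Ed E i) \<and> real (card (Ed E i)) < N i"
    and a: "\<And>i. a i = 1 / (L i * N i)"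
  shows "(\<Sum>(v, w)\<in>P. (depth a J v - depth a J w)\<^sup>2) \<le> 2 * (1 + 1 / c) * (\<Sum>i\<in>J. a i)"
proof -
  let ?K = "1 + 1 / c"
  have Lpos: "L i > 0" if "i \<in> J" for i using LN(1) LN(2)[OF J(2)[OF that]] by linarith
  have apos: "a i > 0" if "i \<in> J" for i using Lpos[OF that] LN(3)[OF J(2)[OF that]] by (simp add: a)
  define I where "I v w = {i\<in>J. (v \<in> box_B i) \<noteq> (w \<in> box_B i)}" for v w :: "real ^ 'd"
  have finI: "finite (I v w)" for v w using J(1) by (simp add: I_def)
  have cross: "{v, w} \<in> Ed E i" if "{v, w} \<in> E" "i \<in> I v w" for v w i
    using that unfolding I_def Ed_def by (auto; metis insert_commute)
  have pt: "(depth a J v - depth a J w)\<^sup>2 \<le> (\<Sum>i\<in>I v w. ?K * L i * (a i)\<^sup>2)" if e: "{v, w} \<in> E" for v w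
  proof -
    have "\<bar>depth a J v - depth a J w\<bar> =
        \<bar>\<Sum>i\<in>J. (if v \<notin> box_B i then a i else 0) - (if w \<notin> box_B i then a i else 0)\<bar>"
      using J(1) by (simp add: depth_def sum_subtractf sum.inter_filter)
    also have "\<dots> \<le> (\<Sum>i\<in>J. if (v \<in> box_B i) \<noteq> (w \<in> box_B i) then a i else 0)"
      by (rule order_trans[OF sum_abs]) (intro sum_mono, auto dest: apos)
    also have "\<dots> = (\<Sum>i\<in>I v w. a i)"
      unfolding I_def by (rule sum.inter_filter[OF J(1), symmetric])
    finally have "(depth a J v - depth a J w)\<^sup>2 \<le> (\<Sum>i\<in>I v w. a i)\<^sup>2"
      by (metis abs_ge_zero power2_abs power_mono)
    also have "\<dots> \<le> (\<Sum>i\<in>I v w. (a i)\<^sup>2) * real (card (I v w))"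
      by (rule sum_squared_le_sum_of_squares)
    also have "\<dots> = (\<Sum>i\<in>I v w. real (card (I v w)) * (a i)\<^sup>2)"
      by (simp add: sum_distrib_left mult.commute)
    also have "\<dots> \<le> (\<Sum>i\<in>I v w. ?K * L i * (a i)\<^sup>2)"
    proof (intro sum_mono mult_right_mono)
      fix i assume i: "i \<in> I v w"
      then have iJ: "i \<in> J" and i1: "1 \<le> i" using J(2) by (auto simp: I_def)
      have "real (card (I v w)) \<le> dist v w + 1"
        using finI by (intro card_crossed_boxes) (auto simp: I_def)
      also have "\<dots> \<le> L i + 1" using len[OF i1 cross[OF e i]] by simp
      also have "\<dots> \<le> ?K * L i" using LN(1) LN(2)[OF i1] by (simp add: field_simps)
      finally show "real (card (I v w)) \<le> ?K * L i" .
    qed simp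
    finally show ?thesis .
  qed
  have "(\<Sum>(v, w)\<in>P. (depth a J v - depth a J w)\<^sup>2) \<le> (\<Sum>(v, w)\<in>P. \<Sum>i\<in>I v w. ?K * L i * (a i)\<^sup>2)"
    using pt P(2) by (intro sum_mono) auto
  also have "\<dots> = (\<Sum>p\<in>P. \<Sum>i\<in>J. if i \<in> I (fst p) (snd p) then ?K * L i * (a i)\<^sup>2 else 0)"
    using J(1) by (simp add: case_prod_unfold sum.inter_filter[symmetric] I_def)
  also have "\<dots> = (\<Sum>i\<in>J. \<Sum>p\<in>P. if i \<in> I (fst p) (snd p) then ?K * L i * (a i)\<^sup>2 else 0)"
    by (rule sum.swap)
  also have "\<dots> = (\<Sum>i\<in>J. real (card {p\<in>P. i \<in> I (fst p) (snd p)}) * (?K * L i * (a i)\<^sup>2))"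
    using P(1) by (simp add: sum.inter_filter[symmetric])
  also have "\<dots> \<le> (\<Sum>i\<in>J. 2 * ?K * a i)"
  proof (rule sum_mono)
    fix i assume i: "i \<in> J"
    note i1 = J(2)[OF i]
    have "card {p\<in>P. i \<in> I (fst p) (snd p)} \<le> card {(v, w). {v, w} \<in> Ed E i}"
      using card_ordered_Ed(1) num[OF i1] cross P(2) by (intro card_mono) auto
    also have "\<dots> \<le> 2 * card (Ed E i)" using card_ordered_Ed(2) num[OF i1] by blast
    finally have "real (card {p\<in>P. i \<in> I (fst p) (snd p)}) \<le> 2 * N i"
      using num[OF i1] by linarith
    then have "real (card {p\<in>P. i \<in> I (fst p) (snd p)}) * (?K * L i * (a i)\<^sup>2) \<le> 2 * N i * (?K * L i * (a i)\<^sup>2)"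
      using LN(1) Lpos[OF i] by (intro mult_right_mono) auto
    also have "\<dots> = 2 * ?K * a i * (L i * N i * a i)"
      by (simp add: power2_eq_square)
    also have "L i * N i * a i = 1" using Lpos[OF i] LN(3)[OF i1] by (simp add: a)
    finally show "real (card {p\<in>P. i \<in> I (fst p) (snd p)}) * (?K * L i * (a i)\<^sup>2) \<le> 2 * ?K * a i"
      by simp
  qed
  also have "\<dots> = 2 * ?K * (\<Sum>i\<in>J. a i)" by (simp add: sum_distrib_left)
  finally show ?thesis .
qed

section \<open>Recurrence from cut-offs of small energy\<close>

lemma set_pmf_walk_step:
  assumes C: "conductance E C" and "finite (neighbors E v)" "neighbors E v \<noteq> {}"
  shows "set_pmf (walk_step E C v) = neighbors E v" and "weight E C v > 0"
proof -
  have pos: "C {v, w} > 0" if "w \<in> neighbors E v" for w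
    using C that by (auto simp: conductance_def neighbors_def)
  show w: "weight E C v > 0"
    unfolding weight_def using assms pos by (intro sum_pos) auto
  show "set_pmf (walk_step E C v) = neighbors E v"
    using pos w by (force simp: set_pmf_eq pmf_walk_step[OF assms])
qed

text \<open>
  The decreasing limit \<open>q\<close> of the avoidance probabilities satisfies the one-step equation, so that
  \<open>h\<close>, which is \<open>q\<close> off \<open>u\<close> and \<open>0\<close> at \<open>u\<close>, is harmonic off \<open>u\<close>.  The Caccioppoli inequality forces
  \<open>h\<close> to vanish next to \<open>u\<close>, and \<open>q u\<close>, the probability of no return, is the average of \<open>h\<close> over the
  neighbours of \<open>u\<close>.
\<close>

lemma recurrent_walk_if_small_energy:
  assumes nb: "\<And>v. v \<in> V \<Longrightarrow> finite (neighbors E v) \<and> neighbors E v \<noteq> {} \<and> neighbors E v \<subseteq> V"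
    and C: "conductance E C"
    and energy: "\<And>u \<epsilon>. u \<in> V \<Longrightarrow> 0 < \<epsilon> \<Longrightarrow> \<exists>A f. finite A \<and> A \<subseteq> V \<and>
      (\<forall>v w. {v, w} \<in> E \<longrightarrow> v \<notin> A \<longrightarrow> f v = 0) \<and> f u = 1 \<and>
      (\<Sum>(v, w)\<in>edge_pairs E A. C {v, w} * (f v - f w)\<^sup>2) \<le> \<epsilon>"
  shows "recurrent_walk V E C"
  unfolding recurrent_walk_def random_walk_def
proof
  fix u assume u: "u \<in> V"
  let ?K = "walk_step E C"
  have set_K: "set_pmf (?K v) = neighbors E v" if "v \<in> V" for v
    using set_pmf_walk_step[OF C] nb[OF that] by blast
  have wpos: "weight E C v > 0" if "v \<in> V" for v
    using set_pmf_walk_step[OF C] nb[OF that] by blast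
  have K: "finite (set_pmf (?K v)) \<and> set_pmf (?K v) \<subseteq> V" if "v \<in> V" for v
    using nb[OF that] set_K[OF that] by simp
  have dec: "avoid ?K u (Suc k) v \<le> avoid ?K u k v" if "v \<in> V" for k v
    using avoid_Suc_le[of V ?K v u k, OF K that] .
  define q where "q v = lim (\<lambda>k. avoid ?K u k v)" for v
  have q: "(\<lambda>k. avoid ?K u k v) \<longlonglongrightarrow> q v" if "v \<in> V" for v
  proof -
    have "decseq (\<lambda>k. avoid ?K u k v)" using dec[OF that] by (rule decseq_SucI)
    then obtain l where "(\<lambda>k. avoid ?K u k v) \<longlonglongrightarrow> l"
      using decseq_convergent avoid_nonneg by metis
    then show ?thesis by (simp add: q_def limI)
  qed
  have q0: "0 \<le> q v" and q1: "q v \<le> 1" if "v \<in> V" for v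
  proof -
    show "0 \<le> q v" by (rule LIMSEQ_le_const[OF q[OF that]]) (simp add: avoid_nonneg)
    have "antimono (\<lambda>k. avoid ?K u k v)" using dec[OF that] by (rule decseq_SucI)
    then have "avoid ?K u k v \<le> avoid ?K u 0 v" for k by (rule antimonoD) simp
    then show "q v \<le> 1" using q[OF that] by (intro LIMSEQ_le_const2) auto
  qed
  define h where "h v = (if v \<in> V \<and> v \<noteq> u then q v else 0)" for v
  have q_step: "q v = (\<Sum>w\<in>neighbors E v. C {v, w} * h w) / weight E C v" if v: "v \<in> V" for v
  proof -
    have "(\<lambda>k. avoid ?K u (Suc k) v) \<longlonglongrightarrow> (\<Sum>w\<in>neighbors E v - {u}. pmf (?K v) w * q w)"
      unfolding avoid.simps set_K[OF v] using nb[OF v] by (intro tendsto_sum tendsto_mult_left q) auto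
    from LIMSEQ_unique[OF LIMSEQ_Suc[OF q[OF v]] this]
    have "q v = (\<Sum>w\<in>neighbors E v - {u}. pmf (?K v) w * q w)" .
    also have "\<dots> = (\<Sum>w\<in>neighbors E v. pmf (?K v) w * h w)"
      using nb[OF v] by (intro sum.mono_neutral_cong_left) (auto simp: h_def)
    also have "\<dots> = (\<Sum>w\<in>neighbors E v. C {v, w} * h w) / weight E C v"
      using nb[OF v] by (simp add: pmf_walk_step[OF C] sum_divide_distrib)
    finally show ?thesis .
  qed
  have harm: "h v * (\<Sum>w\<in>neighbors E v. C {v, w} * (h w - h v)) = 0" if v: "v \<in> V" for v
  proof (cases "v = u")
    case False
    then have "h v = (\<Sum>w\<in>neighbors E v. C {v, w} * h w) / weight E C v"
      using q_step[OF v] v by (simp add: h_def)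
    then have "(\<Sum>w\<in>neighbors E v. C {v, w} * h w) = h v * weight E C v"
      using wpos[OF v] by (simp add: field_simps)
    then have "(\<Sum>w\<in>neighbors E v. C {v, w} * (h w - h v)) = 0"
      by (simp add: right_diff_distrib sum_subtractf weight_def sum_distrib_right[symmetric] mult.commute[of "h v"])
    then show ?thesis by simp
  qed (simp add: h_def)
  have h01: "0 \<le> h v" "h v \<le> 1" for v using q0 q1 by (auto simp: h_def)
  have Cpos: "C {v, w} > 0" if "{v, w} \<in> E" for v w using C that by (auto simp: conductance_def)
  have "(\<Sum>w\<in>neighbors E u. C {u, w} * (h w)\<^sup>2) \<le> 0"
  proof (rule field_le_epsilon)
    fix e :: real assume "0 < e"
    then have "0 < e / 8" by simp
    from energy[OF u this] obtain A f where A: "finite A" "A \<subseteq> V"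
      and f: "\<And>v w. {v, w} \<in> E \<Longrightarrow> v \<notin> A \<Longrightarrow> f v = 0" "f u = 1"
      and en: "(\<Sum>(v, w)\<in>edge_pairs E A. C {v, w} * (f v - f w)\<^sup>2) \<le> e / 8" by blast
    have uA: "u \<in> A" using nb[OF u] f by (fastforce simp: neighbors_def)
    have nbA: "finite (neighbors E v)" if "v \<in> A" for v using nb A that by blast
    let ?t = "\<lambda>(v, w). C {v, w} * ((f v)\<^sup>2 + (f w)\<^sup>2) * (h v - h w)\<^sup>2"
    have "(\<Sum>w\<in>neighbors E u. C {u, w} * (h w)\<^sup>2) \<le> (\<Sum>w\<in>neighbors E u. ?t (u, w))"
    proof (rule sum_mono)
      fix w assume "w \<in> neighbors E u"
      then have "0 < C {u, w}" using Cpos by (simp add: neighbors_def)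
      moreover have "h u = 0" by (simp add: h_def)
      ultimately show "C {u, w} * (h w)\<^sup>2 \<le> ?t (u, w)"
        using f(2) by (simp add: distrib_left distrib_right)
    qed
    also have "\<dots> = sum ?t (Pair u ` neighbors E u)"
      by (subst sum.reindex) (auto simp: inj_on_def)
    also have "\<dots> \<le> sum ?t (edge_pairs E A)"
    proof (rule sum_mono2)
      show "finite (edge_pairs E A)" by (rule finite_edge_pairs[OF A(1) nbA])
      show "Pair u ` neighbors E u \<subseteq> edge_pairs E A"
        using uA by (auto simp: edge_pairs_def neighbors_def)
      show "0 \<le> ?t p" if "p \<in> edge_pairs E A - Pair u ` neighbors E u" for p
        using that Cpos by (force simp: edge_pairs_def intro!: mult_nonneg_nonneg dest: less_imp_le)
    qed
    also have "\<dots> \<le> 8 * (\<Sum>(v, w)\<in>edge_pairs E A. C {v, w} * (f v - f w)\<^sup>2)"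
    proof (rule caccioppoli[OF A(1) nbA C])
      fix v assume "v \<in> A"
      then show "0 \<le> h v * (\<Sum>w\<in>neighbors E v. C {v, w} * (h w - h v))"
        using harm A(2) by fastforce
    qed (use f h01 in auto)
    also have "\<dots> \<le> 0 + e" using en by simp
    finally show "(\<Sum>w\<in>neighbors E u. C {u, w} * (h w)\<^sup>2) \<le> 0 + e" .
  qed
  moreover have nonneg: "0 \<le> C {u, w} * (h w)\<^sup>2" if "w \<in> neighbors E u" for w
    using Cpos[of u w] that by (simp add: neighbors_def)
  ultimately have "(\<Sum>w\<in>neighbors E u. C {u, w} * (h w)\<^sup>2) = 0"
    by (intro antisym sum_nonneg) auto
  then have "\<forall>w\<in>neighbors E u. C {u, w} * (h w)\<^sup>2 = 0"
    using nonneg nb[OF u] by (subst (asm) sum_nonneg_eq_0_iff) auto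
  then have "h w = 0" if "w \<in> neighbors E u" for w
    using Cpos[of u w] that by (fastforce simp: neighbors_def)
  then have "q u = 0" using q_step[OF u] by simp
  then have "(\<lambda>k. avoid ?K u k u) \<longlonglongrightarrow> 0" using q[OF u] by simp
  then show "AE X in chain ?K u. \<exists>n\<ge>1. X n = u"
    using AE_chain_return[of V ?K u, OF K u] by blast
qed

lemma neighbors_connected_infinite:
  assumes "graph V E" "connected_graph V E" "infinite V" "v \<in> V"
  shows "neighbors E v \<noteq> {}" "neighbors E v \<subseteq> V"
proof -
  obtain w where w: "w \<in> V" "w \<noteq> v"
    using assms(3) by (metis finite.emptyI finite.insertI finite_subset insertI1 subsetI)
  then have "(\<lambda>x y. {x, y} \<in> E)\<^sup>*\<^sup>* v w" using assms by (auto simp: connected_graph_def)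
  then show "neighbors E v \<noteq> {}"
    using w(2) by (cases rule: converse_rtranclpE) (auto simp: neighbors_def)
  show "neighbors E v \<subseteq> V"
    using assms(1) by (fastforce simp: neighbors_def graph_def doubleton_eq_iff)
qed

lemma bounded_box_B: "bounded (box_B i :: (real ^ 'd) set)"
proof -
  have "box_B i = cbox (\<chi> k. - real i) (\<chi> k. real i :: real ^ 'd)"
    by (auto simp: box_B_def mem_box_cart)
  then show ?thesis by simp
qed

theorem mainTheorem3:
  fixes V :: "(real ^ 'd) set" and E :: "(real ^ 'd) set set"
    and C :: "(real ^ 'd) set \<Rightarrow> real"
    and L N :: "nat \<Rightarrow> real" and c :: real
  assumes "graph V E" and "connected_graph V E" and "infinite V"
    and "locally_finite_graph V E"
    and "conductance E C" and "bdd_above (C ` E)"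
    and "\<And>i. i \<ge> 1 \<Longrightarrow> L i > 0" and "\<And>i. i \<ge> 1 \<Longrightarrow> N i > 0"
    and L_bounded_below: "c > 0" "\<And>i. i \<ge> 1 \<Longrightarrow> L i \<ge> c"
    and "filterlim (\<lambda>n. \<Sum>i=1..n. 1 / (L i * N i)) at_top sequentially"
    and "\<And>i u v. i \<ge> 1 \<Longrightarrow> {u, v} \<in> Ed E i \<Longrightarrow> dist u v < L i"
    and "\<And>i. i \<ge> 1 \<Longrightarrow> finite (Ed E i) \<and> real (card (Ed E i)) < N i"
  shows "recurrent_walk V E C"
proof (rule recurrent_walk_if_small_energy)
  note G = assms(1-3) and C = assms(5) and N = assms(8) and div = assms(11)
    and len = assms(12) and num = assms(13)
  have lf: "finite (neighbors E v)" if "v \<in> V" for v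
    using assms(4) that by (simp add: locally_finite_graph_def)
  show "finite (neighbors E v) \<and> neighbors E v \<noteq> {} \<and> neighbors E v \<subseteq> V" if "v \<in> V" for v
    using neighbors_connected_infinite[OF G that] lf[OF that] by blast
  show "conductance E C" by (rule C)
  fix u \<epsilon> assume u: "u \<in> V" and \<epsilon>: "0 < (\<epsilon> :: real)"
  obtain M0 where "\<And>e. e \<in> E \<Longrightarrow> C e \<le> M0"
    using assms(6) by (auto simp: bdd_above_def)
  then obtain M where M: "\<And>e. e \<in> E \<Longrightarrow> C e \<le> M" "0 < M"
    by (intro that[of "max M0 1"]) (auto intro: max.coboundedI1)
  define a where "a i = 1 / (L i * N i)" for i
  have apos: "0 < a i" if "1 \<le> i" for i
    using assms(7) N that by (simp add: a_def)
  obtain k where "norm u \<le> real k" using real_arch_simple by blast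
  then obtain j :: nat where j: "1 \<le> j" "norm u \<le> real j"
    by (intro that[of "max 1 k"]) auto
  define B where "B = 2 * M * (1 + 1 / c)"
  have B: "0 < B" using M(2) L_bounded_below(1) by (simp add: B_def add_pos_pos)
  have "eventually (\<lambda>n. (\<Sum>i=1..n. a i) \<ge> B / \<epsilon> + (\<Sum>i=1..j. a i)) sequentially"
    using div unfolding filterlim_at_top a_def by blast
  with eventually_ge_at_top[of "j + 1"]
  have "eventually (\<lambda>n. n \<ge> j + 1 \<and> (\<Sum>i=1..n. a i) \<ge> B / \<epsilon> + (\<Sum>i=1..j. a i)) sequentially"
    by eventually_elim simp
  then obtain n where n: "j + 1 \<le> n" "(\<Sum>i=1..n. a i) \<ge> B / \<epsilon> + (\<Sum>i=1..j. a i)"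
    unfolding eventually_sequentially by blast
  \<comment> \<open>Only boxes containing \<open>u\<close> are used, so that \<open>u\<close> has depth \<open>0\<close>; every vertex outside the last
    box has the full depth \<open>S\<close>.\<close>
  define J where "J = {j + 1..n}"
  define S where "S = (\<Sum>i\<in>J. a i)"
  have "{1..n} = {1..j} \<union> J" using n(1) by (auto simp: J_def)
  then have "(\<Sum>i=1..n. a i) = (\<Sum>i=1..j. a i) + S"
    unfolding S_def by (simp add: sum.union_disjoint J_def)
  then have SB: "B / \<epsilon> \<le> S" using n(2) by simp
  then have S: "0 < S" using B \<epsilon> by (smt (verit) divide_pos_pos)
  define f :: "real ^ 'd \<Rightarrow> real" where "f v = 1 - depth a J v / S" for v
  define A where "A = V \<inter> box_B n"
  have A: "finite A" "A \<subseteq> V"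
    using assms(4) bounded_box_B by (auto simp: A_def locally_finite_graph_def)
  have f0: "f v = 0" if "{v, w} \<in> E" "v \<notin> A" for v w
  proof -
    have "v \<in> V" using that(1) assms(1) by (fastforce simp: graph_def doubleton_eq_iff)
    then have "v \<notin> box_B n" using that(2) by (simp add: A_def)
    then have "{i\<in>J. v \<notin> box_B i} = J" using box_B_mono by (fastforce simp: J_def)
    then show ?thesis using S by (simp add: f_def depth_def S_def)
  qed
  have "u \<in> box_B j"
    unfolding box_B_def using j(2) component_le_norm_cart[of u]
    by (auto simp: abs_le_iff intro: order_trans) (smt (verit))
  then have "u \<in> box_B i" if "i \<in> J" for i
    using box_B_mono[of j i] that by (auto simp: J_def)
  then have "{i\<in>J. u \<notin> box_B i} = {}" by blast
  then have fu: "f u = 1" by (simp only: f_def depth_def) simp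
  let ?P = "edge_pairs E A"
  have P: "finite ?P" using finite_edge_pairs[OF A(1)] lf A(2) by blast
  have PE: "\<And>v w. (v, w) \<in> ?P \<Longrightarrow> {v, w} \<in> E" by (simp add: edge_pairs_def)
  have J: "finite J" "\<And>i. i \<in> J \<Longrightarrow> 1 \<le> i" by (auto simp: J_def)
  have "(\<Sum>(v, w)\<in>?P. C {v, w} * (f v - f w)\<^sup>2)
      \<le> (\<Sum>(v, w)\<in>?P. M / S\<^sup>2 * (depth a J v - depth a J w)\<^sup>2)"
  proof (intro sum_mono, clarify)
    fix v w assume "(v, w) \<in> ?P"
    then have "C {v, w} \<le> M" using M(1) PE by blast
    then have "C {v, w} * (f v - f w)\<^sup>2 \<le> M * (f v - f w)\<^sup>2" by (rule mult_right_mono) simp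
    moreover have "(f v - f w)\<^sup>2 = ((depth a J v - depth a J w) / S)\<^sup>2"
      by (simp add: f_def diff_divide_distrib power2_commute)
    ultimately show "C {v, w} * (f v - f w)\<^sup>2 \<le> M / S\<^sup>2 * (depth a J v - depth a J w)\<^sup>2"
      by (simp add: power_divide)
  qed
  also have "\<dots> = M / S\<^sup>2 * (\<Sum>(v, w)\<in>?P. (depth a J v - depth a J w)\<^sup>2)"
    by (simp add: sum_distrib_left case_prod_unfold)
  also have "\<dots> \<le> M / S\<^sup>2 * (2 * (1 + 1 / c) * S)"
    unfolding S_def[symmetric] using M(2)
    by (intro mult_left_mono depth_energy[OF J P PE L_bounded_below N len num a_def, folded S_def]) auto
  also have "\<dots> = B / S" using S by (simp add: B_def power2_eq_square)
  also have "\<dots> \<le> \<epsilon>" using SB S \<epsilon> by (simp add: field_simps)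
  finally show "\<exists>A f. finite A \<and> A \<subseteq> V \<and> (\<forall>v w. {v, w} \<in> E \<longrightarrow> v \<notin> A \<longrightarrow> f v = 0) \<and> f u = 1 \<and>
      (\<Sum>(v, w)\<in>edge_pairs E A. C {v, w} * (f v - f w)\<^sup>2) \<le> \<epsilon>"
    using A f0 fu by blast
qed

end
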